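(* Let $B,M\ge 0$, $T\ge 1$, let $x_1,\dots,x_T\in\mathbb{R}^d$ be any sequence with $\|x_t\|_2\le B$ for all $t$, and let $y_1,\dots,y_T\in\{0,1\}$ be any sequence of outcomes ($x_t$ is revealed before $p_t$ is chosen and $y_t$ is revealed after; both may be chosen arbitrarily). Let $p_1,\dots,p_T\in[0,1]$ be the predictions produced by Defensive Forecasting for matching empirical moments with feature map $$\Phi(x,p)=\begin{bmatrix}1\\ p\\ x\end{bmatrix}\in\mathbb{R}^{d+2}.$$ Then $$\sum_{t=1}^T(y_t-p_t)^2\le \min_{w\in\mathbb{R}^d:\|w\|_2\le M}\ \sum_{t=1}^T\big(y_t-\langle x_t,w\rangle\big)^2+2\sqrt{T(5+4M^2)(2+B^2)}.$$
   Context: Anticorrelation search: given a function $S:[0,1]\to\mathbb{R}$, return $p=1$ if $S(1)\ge 0$; otherwise return $p=0$ if $S(0)\le 0$; otherwise return some $p\in[0,1]$ with $S(p)=0$ (exact root finding). Defensive Forecasting for matching empirical moments with feature map $\Phi$: at each round $t$, receive $x_t$, define $S_t(p)=\sum_{s=1}^{t-1}\langle\Phi(x_t,p),\Phi(x_s,p_s)\rangle(y_s-p_s)$ (so $S_1\equiv 0$), let $p_t$ be the output of anticorrelation search on $S_t$, then observe $y_t$. *)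

theory Defs
  imports "HOL-Analysis.Analysis"
begin

text \<open>
  A relation between \<open>S\<close> and the returned \<open>p\<close>, rather than a function: in the root-finding case any
  root in the unit interval may be returned. Only the values of \<open>S\<close> on \<open>{0..1}\<close> matter.
\<close>

definition anticorrelation_search :: "(real \<Rightarrow> real) \<Rightarrow> real \<Rightarrow> bool" where
  "anticorrelation_search S p \<longleftrightarrow>
     (if S 1 \<ge> 0 then p = 1
      else if S 0 \<le> 0 then p = 0
      else p \<in> {0..1} \<and> S p = 0)"

definition df_score ::
  "('x \<Rightarrow> real \<Rightarrow> 'h::real_inner) \<Rightarrow> (nat \<Rightarrow> 'x) \<Rightarrow> (nat \<Rightarrow> real) \<Rightarrow> (nat \<Rightarrow> real)
    \<Rightarrow> nat \<Rightarrow> real \<Rightarrow> real" where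
  "df_score \<Phi> x y p t q = (\<Sum>s\<in>{1..<t}. (\<Phi> (x t) q \<bullet> \<Phi> (x s) (p s)) * (y s - p s))"

text \<open>
  \<open>p\<close> is a transcript of predictions on the realised sequences \<open>x\<close>, \<open>y\<close> over rounds \<open>1, \<dots>, T\<close>.
  The condition on \<open>p t\<close> involves \<open>x\<close> up to round \<open>t\<close> and \<open>y\<close>, \<open>p\<close> before round \<open>t\<close> only, so a
  statement about all such triples covers adaptively chosen \<open>x\<close> and \<open>y\<close>.
\<close>

definition defensive_forecasting ::
  "('x \<Rightarrow> real \<Rightarrow> 'h::real_inner) \<Rightarrow> nat \<Rightarrow> (nat \<Rightarrow> 'x) \<Rightarrow> (nat \<Rightarrow> real) \<Rightarrow> (nat \<Rightarrow> real)
    \<Rightarrow> bool" where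
  "defensive_forecasting \<Phi> T x y p \<longleftrightarrow>
     (\<forall>t\<in>{1..T}. anticorrelation_search (df_score \<Phi> x y p t) (p t))"

text \<open>
  The stacked vector \<open>[1; p; x]\<close>: the inner product of the product space is the sum of the blockwise
  inner products, so this space is Euclidean space of dimension \<open>d + 2\<close>.
\<close>

definition feature_map :: "real ^ 'd \<Rightarrow> real \<Rightarrow> real \<times> real \<times> (real ^ 'd)" where
  "feature_map x p = (1, p, x)"

text \<open>The search always has an output on the scores of this feature map.\<close>

lemma anticorrelation_search_exists:
  assumes "continuous_on {0..1} S"
  shows "\<exists>p. anticorrelation_search S p"
proof (cases "S 1 \<ge> 0 \<or> S 0 \<le> 0")
  case True
  then show ?thesis by (auto simp: anticorrelation_search_def)
next
  case False
  then have "\<exists>p. 0 \<le> p \<and> p \<le> 1 \<and> S p = 0"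
    using assms by (intro IVT2') auto
  with False show ?thesis by (auto simp: anticorrelation_search_def)
qed

lemma continuous_on_df_score_feature_map:
  "continuous_on A (df_score feature_map x y p t)"
  unfolding df_score_def feature_map_def inner_prod_def by (auto intro!: continuous_intros)

end

theory Submission
  imports Defs
begin

text \<open>
  Put \<open>V = \<Sum>t. (y\<^sub>t - p\<^sub>t) \<Phi>(x\<^sub>t, p\<^sub>t)\<close>. The search output makes the cross term
  \<open>(y\<^sub>t - p\<^sub>t) S\<^sub>t(p\<^sub>t)\<close> nonpositive, so \<open>\<parallel>V\<parallel>\<^sup>2\<close> grows by at most
  \<open>\<parallel>\<Phi>(x\<^sub>t, p\<^sub>t)\<parallel>\<^sup>2 \<le> 2 + B\<^sup>2\<close> per round. The regret against \<open>w\<close> is at most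
  \<open>2 \<langle>V, (0, -1, w)\<rangle>\<close>, and Cauchy--Schwarz concludes, with \<open>1 + M\<^sup>2\<close> in place of
  the constant \<open>5 + 4 M\<^sup>2\<close>.
\<close>

lemma anticorrelation_search_range:
  assumes "anticorrelation_search S p"
  shows "p \<in> {0..1}"
  using assms by (auto simp: anticorrelation_search_def split: if_splits)

text \<open>At a root the product vanishes. At the endpoints the signs are opposite:
  \<open>p = 1\<close> forces \<open>y - p \<le> 0\<close> while \<open>S 1 \<ge> 0\<close>, and
  \<open>p = 0\<close> forces \<open>y - p \<ge> 0\<close> while \<open>S 0 \<le> 0\<close>.\<close>

lemma anticorrelation_search_nonpos:
  assumes "anticorrelation_search S p" and "y \<in> {0..1}"
  shows "(y - p) * S p \<le> 0"
  using assms
  by (auto simp: anticorrelation_search_def mult_nonpos_nonneg mult_nonneg_nonpos split: if_splits)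

text \<open>Pulls the current feature out of the score, so that the score at the prediction becomes
  the cross term in the expansion of the squared norm of the residual sum.\<close>

lemma df_score_eq_inner:
  "df_score \<Phi> x y p t q = \<Phi> (x t) q \<bullet> (\<Sum>s\<in>{1..<t}. (y s - p s) *\<^sub>R \<Phi> (x s) (p s))"
  by (simp add: df_score_def inner_sum_right mult.commute)

lemma defensive_forecasting_norm_residual_sum:
  assumes df: "defensive_forecasting \<Phi> T x y p"
    and y: "\<And>t. t \<in> {1..T} \<Longrightarrow> y t \<in> {0..1}"
    and bound: "\<And>t. t \<in> {1..T} \<Longrightarrow> (norm (\<Phi> (x t) (p t)))\<^sup>2 \<le> C"
  shows "(norm (\<Sum>t=1..T. (y t - p t) *\<^sub>R \<Phi> (x t) (p t)))\<^sup>2 \<le> real T * C"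
proof -
  define V where "V n = (\<Sum>t=1..n. (y t - p t) *\<^sub>R \<Phi> (x t) (p t))" for n
  have "(norm (V n))\<^sup>2 \<le> real n * C" if "n \<le> T" for n
    using that
  proof (induction n)
    case 0
    then show ?case by (simp add: V_def)
  next
    case (Suc n)
    define t where "t = Suc n"
    define v where "v = \<Phi> (x t) (p t)"
    have t: "t \<in> {1..T}" using Suc.prems by (simp add: t_def)
    have search: "anticorrelation_search (df_score \<Phi> x y p t) (p t)"
      using df t by (simp add: defensive_forecasting_def)
    have "(y t - p t) * df_score \<Phi> x y p t (p t) \<le> 0"
      using anticorrelation_search_nonpos[OF search y[OF t]] .
    \<comment> \<open>The score of round \<open>t = Suc n\<close> sums over \<open>{1..<t}\<close>,
      which is \<open>{1..n}\<close>, the index set of \<open>V n\<close>.\<close>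
    then have cross: "(y t - p t) * (v \<bullet> V n) \<le> 0"
      by (simp add: df_score_eq_inner V_def v_def t_def atLeastLessThanSuc_atLeastAtMost)
    have "\<bar>y t - p t\<bar> \<le> 1"
      using anticorrelation_search_range[OF search] y[OF t] by auto
    then have "(y t - p t)\<^sup>2 * (norm v)\<^sup>2 \<le> 1 * (norm v)\<^sup>2"
      by (intro mult_right_mono) (simp_all add: abs_square_le_1)
    also have "\<dots> \<le> C" using bound[OF t] by (simp add: v_def)
    finally have step: "(y t - p t)\<^sup>2 * (norm v)\<^sup>2 \<le> C" .
    have "V (Suc n) = V n + (y t - p t) *\<^sub>R v"
      by (simp add: V_def v_def t_def)
    \<comment> \<open>The middle term is nonpositive by \<open>cross\<close> and the last is at most
      \<open>C\<close> by \<open>step\<close>, so one round adds at most \<open>C\<close>.\<close>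
    then have "(norm (V (Suc n)))\<^sup>2
        = (norm (V n))\<^sup>2 + 2 * ((y t - p t) * (v \<bullet> V n)) + (y t - p t)\<^sup>2 * (norm v)\<^sup>2"
      unfolding power2_norm_eq_inner
      by (simp add: inner_add_left inner_add_right inner_commute power2_eq_square)
    with Suc cross step show ?case by (simp add: algebra_simps)
  qed
  then show ?thesis by (simp add: V_def)
qed

lemma norm_feature_map_sq: "(norm (feature_map x q))\<^sup>2 = 1 + q\<^sup>2 + (norm x)\<^sup>2"
  by (simp add: feature_map_def norm_Pair)

text \<open>Linearise the loss difference by dropping the square
  \<open>(x \<bullet> w - q)\<^sup>2\<close>. The remaining factor \<open>x \<bullet> w - q\<close>
  is linear in the features: the entry \<open>-1\<close> of the comparator picks out
  \<open>-q\<close>, the entry \<open>w\<close> picks out \<open>x \<bullet> w\<close>, and the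
  constant feature gets weight 0.\<close>

lemma squared_loss_regret_le_inner:
  "(y - q)\<^sup>2 - (y - x \<bullet> w)\<^sup>2 \<le> 2 * ((y - q) *\<^sub>R feature_map x q \<bullet> (0, -1, w))"
proof -
  have "(y - q)\<^sup>2 - (y - x \<bullet> w)\<^sup>2 = 2 * ((y - q) * (x \<bullet> w - q)) - (x \<bullet> w - q)\<^sup>2"
    by (simp add: power2_eq_square algebra_simps)
  also have "\<dots> \<le> 2 * ((y - q) * (x \<bullet> w - q))" by simp
  also have "\<dots> = 2 * ((y - q) *\<^sub>R feature_map x q \<bullet> (0, -1, w))"
    by (simp add: feature_map_def algebra_simps)
  finally show ?thesis .
qed

lemma defensive_forecasting_regret:
  fixes x :: "nat \<Rightarrow> real ^ 'd" and y p :: "nat \<Rightarrow> real"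
  assumes x: "\<And>t. t \<in> {1..T} \<Longrightarrow> norm (x t) \<le> B"
    and y: "\<And>t. t \<in> {1..T} \<Longrightarrow> y t \<in> {0..1}"
    and df: "defensive_forecasting feature_map T x y p"
    and w: "norm w \<le> M"
  shows "(\<Sum>t=1..T. (y t - p t)\<^sup>2)
    \<le> (\<Sum>t=1..T. (y t - x t \<bullet> w)\<^sup>2) + 2 * sqrt (real T * (1 + M\<^sup>2) * (2 + B\<^sup>2))"
proof -
  define V where "V = (\<Sum>t=1..T. (y t - p t) *\<^sub>R feature_map (x t) (p t))"
  define u :: "real \<times> real \<times> (real ^ 'd)" where "u = (0, -1, w)"
  have feature_bound: "(norm (feature_map (x t) (p t)))\<^sup>2 \<le> 2 + B\<^sup>2" if t: "t \<in> {1..T}" for t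
  proof -
    have "p t \<in> {0..1}"
      using df t anticorrelation_search_range unfolding defensive_forecasting_def by blast
    then have "(p t)\<^sup>2 \<le> 1" by (simp add: power_le_one)
    moreover have "(norm (x t))\<^sup>2 \<le> B\<^sup>2"
      using x[OF t] by (simp add: power_mono)
    ultimately show ?thesis by (simp add: norm_feature_map_sq)
  qed
  have "(norm V)\<^sup>2 \<le> real T * (2 + B\<^sup>2)"
    unfolding V_def using df y feature_bound by (rule defensive_forecasting_norm_residual_sum)
  \<comment> \<open>The 1 comes from the entry \<open>-1\<close> of \<open>u\<close>.\<close>
  moreover have "(norm u)\<^sup>2 \<le> 1 + M\<^sup>2"
    using w by (simp add: u_def norm_Pair power_mono)
  ultimately have "(norm V)\<^sup>2 * (norm u)\<^sup>2 \<le> (real T * (2 + B\<^sup>2)) * (1 + M\<^sup>2)"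
    by (intro mult_mono) auto
  \<comment> \<open>It suffices to compare squares, which the preceding product bound does.\<close>
  then have V_u: "norm V * norm u \<le> sqrt (real T * (1 + M\<^sup>2) * (2 + B\<^sup>2))"
    by (intro real_le_rsqrt) (simp add: power_mult_distrib mult_ac)
  have "(\<Sum>t=1..T. (y t - p t)\<^sup>2) - (\<Sum>t=1..T. (y t - x t \<bullet> w)\<^sup>2)
      \<le> (\<Sum>t=1..T. 2 * ((y t - p t) *\<^sub>R feature_map (x t) (p t) \<bullet> u))"
    unfolding sum_subtractf[symmetric] u_def
    by (intro sum_mono squared_loss_regret_le_inner)
  also have "\<dots> = 2 * (V \<bullet> u)"
    by (simp only: V_def inner_sum_left sum_distrib_left)
  also have "\<dots> \<le> 2 * (norm V * norm u)"
    using norm_cauchy_schwarz[of V u] by simp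
  finally show ?thesis using V_u by simp
qed

text \<open>Compactness of the closed ball, nonempty since \<open>M \<ge> 0\<close>. This makes the
  minimum over comparators an attained value.\<close>

lemma is_arg_min_norm_le_exists:
  fixes f :: "'a::euclidean_space \<Rightarrow> real"
  assumes "continuous_on (cball 0 M) f" and "M \<ge> 0"
  shows "\<exists>w. is_arg_min f (\<lambda>w. norm w \<le> M) w"
proof -
  obtain w where "w \<in> cball 0 M" "\<And>v. v \<in> cball 0 M \<Longrightarrow> f w \<le> f v"
    using continuous_attains_inf[OF compact_cball _ assms(1)] assms(2) by auto
  then have "is_arg_min f (\<lambda>w. norm w \<le> M) w"
    by (auto simp: is_arg_min_def not_less)
  then show ?thesis ..
qed

theorem mainTheorem2:
  fixes B M :: real and T :: nat
    and x :: "nat \<Rightarrow> real ^ 'd" and y p :: "nat \<Rightarrow> real"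
  assumes "B \<ge> 0" and "M \<ge> 0" and "T \<ge> 1"
    and "\<And>t. t \<in> {1..T} \<Longrightarrow> norm (x t) \<le> B"
    and "\<And>t. t \<in> {1..T} \<Longrightarrow> y t \<in> {0, 1}"
    and "defensive_forecasting feature_map T x y p"
  shows "\<exists>w. is_arg_min (\<lambda>w. \<Sum>t=1..T. (y t - x t \<bullet> w)\<^sup>2) (\<lambda>w. norm w \<le> M) w \<and>
    (\<Sum>t=1..T. (y t - p t)\<^sup>2) \<le>
      (\<Sum>t=1..T. (y t - x t \<bullet> w)\<^sup>2) + 2 * sqrt (real T * (5 + 4 * M\<^sup>2) * (2 + B\<^sup>2))"
proof -
  have "continuous_on (cball 0 M) (\<lambda>w. \<Sum>t=1..T. (y t - x t \<bullet> w)\<^sup>2)"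
    by (intro continuous_intros)
  from is_arg_min_norm_le_exists[OF this \<open>M \<ge> 0\<close>] obtain w
    where w: "is_arg_min (\<lambda>w. \<Sum>t=1..T. (y t - x t \<bullet> w)\<^sup>2) (\<lambda>w. norm w \<le> M) w" ..
  have y01: "y t \<in> {0..1}" if "t \<in> {1..T}" for t
    using assms(5)[OF that] by auto
  have "norm w \<le> M" using w by (simp add: is_arg_min_def)
  from defensive_forecasting_regret[OF assms(4) y01 assms(6) this]
  have "(\<Sum>t=1..T. (y t - p t)\<^sup>2)
      \<le> (\<Sum>t=1..T. (y t - x t \<bullet> w)\<^sup>2) + 2 * sqrt (real T * (1 + M\<^sup>2) * (2 + B\<^sup>2))" .
  \<comment> \<open>Relaxes the sharper constant via
    \<open>1 + M\<^sup>2 \<le> 5 + 4 * M\<^sup>2\<close>.\<close>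
  moreover have "sqrt (real T * (1 + M\<^sup>2) * (2 + B\<^sup>2))
      \<le> sqrt (real T * (5 + 4 * M\<^sup>2) * (2 + B\<^sup>2))"
    by (intro real_sqrt_le_mono mult_right_mono mult_left_mono) auto
  ultimately have "(\<Sum>t=1..T. (y t - p t)\<^sup>2)
      \<le> (\<Sum>t=1..T. (y t - x t \<bullet> w)\<^sup>2) + 2 * sqrt (real T * (5 + 4 * M\<^sup>2) * (2 + B\<^sup>2))"
    by linarith
  with w show ?thesis by blast
qed

end
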